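(* Let $d\ge3$. If $m(d-2,d-1,d)$ does not exist, then $m(n,k,d)$ exists for no pair of integers $(n,k)$ with $0\le n<k<d$. If $m(d-2,d,d)$ does not exist, then $m(n,d,d)$ exists for no integer $n$ with $0\le n\le d-2$.
   Context: $\mathcal{P}_d$ denotes the open cone of real symmetric positive definite $d\times d$ matrices and $\overline{\mathcal{P}_d}$ its closure. For $0\le k\le d$, $I(k,d)$ is the $d\times d$ diagonal matrix whose first $d-k$ diagonal entries are $0$ and last $k$ are $1$. For real $p\ge0$, $m(2p,k,d)$ denotes a positive measure on $\overline{\mathcal{P}_d}$ such that for all $s\in\mathcal{P}_d$, $\int_{\overline{\mathcal{P}_d}}e^{-\operatorname{tr}(sx)}\,m(2p,k,d)(dx)=(\det s)^{-p}\exp(\operatorname{tr}(s^{-1}I(k,d)))$; "exists" means such a measure exists. *)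

theory Defs
  imports "HOL-Analysis.Analysis"
begin

text \<open>Real symmetric positive definite d x d matrices, d = CARD('n).\<close>
definition pos_def_mats :: "(real^'n^'n) set" where
  "pos_def_mats = {A. transpose A = A \<and> (\<forall>x::real^'n. x \<noteq> 0 \<longrightarrow> x \<bullet> (A *v x) > 0)}"

text \<open>I(k,d): diagonal, first d-k diagonal entries 0, last k entries 1
  (indices ordered by the well-order on 'n).\<close>
definition Imat :: "nat \<Rightarrow> ((real, 'n::{finite,wellorder}) vec, 'n) vec" where
  "Imat k = (\<chi> i j. if i = j \<and> CARD('n) - k \<le> card {l. l < i} then 1 else 0)"

text \<open>Existence of m(2p,k,d): a positive (Borel) measure on the closure of the cone
  whose Laplace transform is (det s)^(-p) exp(tr(s^{-1} I(k,d))) on the open cone.\<close>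
definition m_exists :: "'n::{finite,wellorder} itself \<Rightarrow> real \<Rightarrow> nat \<Rightarrow> bool" where
  "m_exists _ p k \<longleftrightarrow>
     (\<exists>M :: ((real, 'n) vec, 'n) vec measure.
        sets M = sets borel \<and>
        emeasure M (UNIV - closure pos_def_mats) = 0 \<and>
        (\<forall>s\<in>(pos_def_mats :: ((real, 'n) vec, 'n) vec set).
           (\<integral>\<^sup>+ x. ennreal (exp (- trace (s ** x))) \<partial>M)
             = ennreal (det s powr (- p) * exp (trace (matrix_inv s ** (Imat k :: ((real, 'n) vec, 'n) vec))))))"

text \<open>m(n,k,d) with first parameter n = 2p.\<close>
definition m_exists2 :: "'n::{finite,wellorder} itself \<Rightarrow> real \<Rightarrow> nat \<Rightarrow> bool" where
  "m_exists2 T n k = m_exists T (n / 2) k"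

end

theory Submission
  imports Defs "HOL-Probability.Distributions"
begin

(* Proposition 2.3: existence of m(n,k,d) propagates upwards in n, and in (n,k) jointly.

   Let M be a measure on the closed cone with Laplace transform
     LT M s = \<integral> exp(-tr(s x)) dM(x) = det(s)^(-p) exp(tr(s^(-1) A)).
   The key step (laplace_rep_add_outer) shows that for every vector e there is a measure M'
   on the closed cone with LT M' s = det(s)^(-(p+1/2)) exp(tr(s^(-1) (A + e e^T))):
   M' is the image of M \<otimes> N under (a, x) \<mapsto> a + x x^T, where N has density
   exp(2 e\<cdot>x) / pi^(d/2) with respect to Lebesgue measure.  Its Laplace transform factors
   through the Gaussian integral
     \<integral> exp(2 e\<cdot>x - x\<cdot>s x) dx = pi^(d/2) det(s)^(-1/2) exp(e\<cdot>s^(-1) e),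
   proved by writing V^T s V = 1 (Gram-Schmidt for the form x\<cdot>s y) and substituting x = V y.
   With e = 0 this raises n by one and keeps k; with e a standard basis vector it raises both,
   since I(k+1,d) = I(k,d) + e e^T.  From (n,k) with n < k < d one thus reaches (d-2,d-1), and
   from (n,d) with n \<le> d-2 one reaches (d-2,d); the proposition is the contrapositive.

   Sections: positive definite forms; linear change of variables for Lebesgue measure;
   Gaussian integrals; outer products; the key step; iteration and the proposition. *)


section \<open>Positive definite forms\<close>

lemma pos_def_mats_symmetric: "s \<in> pos_def_mats \<Longrightarrow> transpose s = s"
  by (simp add: pos_def_mats_def)

lemma pos_def_mats_positive: "s \<in> pos_def_mats \<Longrightarrow> x \<noteq> 0 \<Longrightarrow> x \<bullet> (s *v x) > 0"
  by (simp add: pos_def_mats_def)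

text \<open>The bilinear form of a symmetric matrix is symmetric.\<close>
lemma symmetric_form_commute:
  fixes s :: "real^'n^'n"
  assumes "transpose s = s"
  shows "x \<bullet> (s *v y) = y \<bullet> (s *v x)"
  by (metis assms dot_lmul_matrix inner_commute transpose_transpose vector_transpose_matrix)

text \<open>Gram-Schmidt step: an s-orthonormal family with fewer than d members
  can be extended by one more s-unit vector s-orthogonal to all of it.\<close>
lemma pos_def_orthonormal_extend:
  fixes s :: "real^'n^'n"
  assumes s: "s \<in> pos_def_mats" and S: "finite S" "card S < CARD('n)"
    and f: "\<forall>i\<in>S. \<forall>j\<in>S. f i \<bullet> (s *v f j) = (if i = j then 1 else 0)"
  shows "\<exists>w. w \<bullet> (s *v w) = 1 \<and> (\<forall>j\<in>S. f j \<bullet> (s *v w) = 0)"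
proof -
  have dim_lt: "dim (span (f ` S)) < CARD('n)"
    using S card_image_le[OF S(1), of f] dim_le_card'[of "f ` S"] dim_span[of "f ` S"]
    by (simp add: finite_imageI)
  have "span (f ` S) \<noteq> UNIV"
  proof
    assume "span (f ` S) = UNIV"
    then have "dim (span (f ` S)) = CARD('n)" by simp
    with dim_lt show False by simp
  qed
  then obtain u where u: "u \<notin> span (f ` S)" by blast
  define w where "w = u - (\<Sum>j\<in>S. (f j \<bullet> (s *v u)) *\<^sub>R f j)"
  have "(\<Sum>j\<in>S. (f j \<bullet> (s *v u)) *\<^sub>R f j) \<in> span (f ` S)"
    by (intro span_sum span_scale span_base) auto
  then have "w \<notin> span (f ` S)" using u unfolding w_def by (metis diff_add_cancel span_add)
  then have "w \<noteq> 0" using span_zero by metis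
  have orth: "f j \<bullet> (s *v w) = 0" if j: "j \<in> S" for j
  proof -
    have "f j \<bullet> (s *v w)
        = f j \<bullet> (s *v u) - (\<Sum>l\<in>S. (f l \<bullet> (s *v u)) * (f j \<bullet> (s *v f l)))"
      unfolding w_def
      by (simp add: matrix_vector_mult_diff_distrib linear_sum[OF matrix_vector_mul_linear]
          inner_diff_right inner_sum_right matrix_vector_mult_scaleR)
    also have "(\<Sum>l\<in>S. (f l \<bullet> (s *v u)) * (f j \<bullet> (s *v f l)))
        = (\<Sum>l\<in>S. if l = j then f j \<bullet> (s *v u) else 0)"
      using j f by (intro sum.cong) auto
    finally show ?thesis using j S(1) by simp
  qed
  define c where "c = w \<bullet> (s *v w)"
  have c: "c > 0" unfolding c_def by (rule pos_def_mats_positive[OF s \<open>w \<noteq> 0\<close>])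
  show ?thesis
    using c orth
    by (intro exI[of _ "(1 / sqrt c) *\<^sub>R w"])
      (simp add: matrix_vector_mult_scaleR c_def[symmetric] power2_eq_square[symmetric])
qed

text \<open>Every positive definite matrix admits an s-orthonormal basis.\<close>
lemma pos_def_orthonormal_basis:
  fixes s :: "real^'n^'n"
  assumes s: "s \<in> pos_def_mats"
  shows "\<exists>f::'n \<Rightarrow> real^'n. \<forall>i j. f i \<bullet> (s *v f j) = (if i = j then 1 else 0)"
proof -
  have "\<exists>f::'n \<Rightarrow> real^'n. \<forall>i\<in>S. \<forall>j\<in>S. f i \<bullet> (s *v f j) = (if i = j then 1 else 0)"
    if "finite S" for S :: "'n set"
    using that
  proof (induction S rule: finite_induct)
    case empty then show ?case by simp
  next
    case (insert i S)
    then obtain f where f: "\<forall>i\<in>S. \<forall>j\<in>S. f i \<bullet> (s *v f j) = (if i = j then 1 else 0)" by blast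
    have "card S < card (insert i S)" using insert by simp
    also have "\<dots> \<le> CARD('n)" by (rule card_mono) auto
    finally obtain w where w: "w \<bullet> (s *v w) = 1" "\<forall>j\<in>S. f j \<bullet> (s *v w) = 0"
      using pos_def_orthonormal_extend[OF s insert(1) _ f] by blast
    show ?case
      using f w insert(2) symmetric_form_commute[OF pos_def_mats_symmetric[OF s]]
      by (intro exI[of _ "f(i := w)"]) auto
  qed
  from this[of UNIV] show ?thesis by simp
qed

text \<open>Matrix form: a positive definite matrix is congruent to the identity.\<close>
lemma pos_def_congruent_identity:
  fixes s :: "real^'n^'n"
  assumes s: "s \<in> pos_def_mats"
  shows "\<exists>V::real^'n^'n. transpose V ** s ** V = mat 1"
proof -
  obtain f :: "'n \<Rightarrow> real^'n" where f: "\<And>i j. f i \<bullet> (s *v f j) = (if i = j then 1 else 0)"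
    using pos_def_orthonormal_basis[OF s] by blast
  define V :: "real^'n^'n" where "V = (\<chi> r c. f c $ r)"
  have entry: "(transpose V ** s ** V) $ i $ j = f i \<bullet> (s *v f j)" for i j
    by (simp add: V_def matrix_matrix_mult_def matrix_vector_mult_def inner_vec_def transpose_def
        sum_distrib_left sum_distrib_right mult_ac matrix_mul_assoc)
       (rule sum.swap)
  show ?thesis
    by (intro exI[of _ V]) (simp add: vec_eq_iff entry f mat_def)
qed

text \<open>A left inverse of a square matrix is its inverse.\<close>
lemma matrix_inv_left_inverse:
  fixes A B :: "real^'n^'n"
  assumes BA: "B ** A = mat 1"
  shows "matrix_inv A = B"
proof -
  have AB: "A ** B = mat 1" using BA matrix_left_right_inverse by blast
  show ?thesis unfolding matrix_inv_def
  proof (rule someI2[of _ B])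
    show "A ** B = mat 1 \<and> B ** A = mat 1" using AB BA by simp
  next
    fix A' assume inv: "A ** A' = mat 1 \<and> A' ** A = mat 1"
    have "A' = A' ** (A ** B)" using AB by simp
    also have "\<dots> = (A' ** A) ** B" by (simp add: matrix_mul_assoc)
    finally show "A' = B" using inv by simp
  qed
qed

text \<open>What the Gaussian computation needs from the congruence V^T s V = 1:
  V is invertible, s^(-1) = V V^T and det(s)^(-1/2) = |det V|.\<close>
lemma pos_def_normalizing_matrix:
  fixes s :: "real^'n^'n"
  assumes s: "s \<in> pos_def_mats"
  obtains V W :: "real^'n^'n"
  where "transpose V ** s ** V = mat 1" "V ** W = mat 1" "W ** V = mat 1"
    "matrix_inv s = V ** transpose V" "det s powr (-1/2) = \<bar>det V\<bar>"
proof -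
  obtain V :: "real^'n^'n" where V: "transpose V ** s ** V = mat 1"
    using pos_def_congruent_identity[OF s] by blast
  have dV: "det V * det V * det s = 1"
    using arg_cong[OF V, of det] by (simp add: det_mul mult_ac)
  then have dV0: "det V \<noteq> 0" by auto
  obtain W where VW: "V ** W = mat 1" and WV: "W ** V = mat 1"
    using dV0 invertible_det_nz[of V] unfolding invertible_def by blast
  have sW: "s = transpose W ** W"
  proof -
    have "transpose W ** (transpose V ** s ** V) ** W = transpose (V ** W) ** s ** (V ** W)"
      by (simp add: matrix_transpose_mul matrix_mul_assoc)
    then show ?thesis using V VW by simp
  qed
  have "(V ** transpose V) ** s = V ** transpose (W ** V) ** W"
    unfolding sW by (simp add: matrix_transpose_mul matrix_mul_assoc)
  also have "\<dots> = mat 1" using WV VW by simp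
  finally have inv: "matrix_inv s = V ** transpose V" by (rule matrix_inv_left_inverse)
  have ds: "det s = 1 / (det V)\<^sup>2" using dV dV0 by (simp add: field_simps power2_eq_square)
  have "det s powr (-1/2) = inverse (det s powr (1/2))"
    by (simp add: powr_minus[symmetric])
  also have "\<dots> = inverse (sqrt (det s))" using ds by (simp add: powr_half_sqrt)
  also have "\<dots> = \<bar>det V\<bar>" unfolding ds by (simp add: real_sqrt_divide)
  finally show thesis using that V VW WV inv by blast
qed


section \<open>Lebesgue measure under an invertible linear map\<close>

lemma matrix_vector_mult_borel_measurable[measurable]:
  "(*v) (V::real^'n^'m) \<in> borel_measurable borel"
  by (intro borel_measurable_continuous_onI linear_continuous_on matrix_vector_mul_bounded_linear)

text \<open>Lebesgue measure is the image of |det V| times Lebesgue measure under x \<mapsto> V x.\<close>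
lemma lborel_eq_density_linear_image:
  fixes V W :: "((real, 'n::{finite,wellorder}) vec, 'n) vec"
  assumes VW: "V ** W = mat 1" and WV: "W ** V = mat 1"
  shows "lborel = density (distr lborel borel ((*v) V)) (\<lambda>_. ennreal \<bar>det V\<bar>)"
proof (rule lborel_eqI)
  fix l u :: "(real, 'n) vec" assume le: "\<And>b. b \<in> Basis \<Longrightarrow> l \<bullet> b \<le> u \<bullet> b"
  have pre: "(*v) V -` box l u = (*v) W ` box l u"
  proof (rule equalityI; rule subsetI)
    fix x assume "x \<in> (*v) V -` box l u"
    moreover have "x = W *v (V *v x)" using WV by (simp add: matrix_vector_mul_assoc)
    ultimately show "x \<in> (*v) W ` box l u" by blast
  next
    fix y assume "y \<in> (*v) W ` box l u"
    then show "y \<in> (*v) V -` box l u" using VW by (auto simp: matrix_vector_mul_assoc)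
  qed
  have borel: "(*v) W ` box l u \<in> sets borel"
    unfolding pre[symmetric] by (rule measurable_sets_borel[OF matrix_vector_mult_borel_measurable]) simp
  have lmeas: "(*v) W ` box l u \<in> lmeasurable"
    by (rule measurable_linear_image) (auto intro: matrix_vector_mul_linear)
  have image: "measure lebesgue ((*v) W ` box l u) = \<bar>det W\<bar> * measure lebesgue (box l u)"
    using measure_linear_image[of "(*v) W" "box l u"]
    by (simp add: matrix_vector_mul_linear matrix_of_matrix_vector_mul)
  have dets: "\<bar>det V\<bar> * \<bar>det W\<bar> = 1"
    using arg_cong[OF VW, of det] by (simp add: det_mul abs_mult[symmetric])
  have "emeasure (density (distr lborel borel ((*v) V)) (\<lambda>_. ennreal \<bar>det V\<bar>)) (box l u)
      = ennreal \<bar>det V\<bar> * emeasure lborel ((*v) V -` box l u)"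
    by (simp add: emeasure_density nn_integral_cmult_indicator emeasure_distr)
  also have "emeasure lborel ((*v) V -` box l u) = ennreal (measure lebesgue ((*v) W ` box l u))"
    unfolding pre using borel emeasure_eq_measure2[OF lmeas] by simp
  also have "ennreal \<bar>det V\<bar> * \<dots> = emeasure lborel (box l u)"
    unfolding image by (simp add: ennreal_mult'[symmetric] mult.assoc[symmetric] dets emeasure_eq_measure2)
  also have "\<dots> = (\<Prod>b\<in>Basis. (u - l) \<bullet> b)" using le by (simp add: emeasure_lborel_box_eq)
  finally show "emeasure (density (distr lborel borel ((*v) V)) (\<lambda>_. ennreal \<bar>det V\<bar>)) (box l u)
      = (\<Prod>b\<in>Basis. (u - l) \<bullet> b)" .
qed simp

text \<open>Linear substitution x = V y in a nonnegative Lebesgue integral.\<close>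
lemma nn_integral_lborel_linear_subst:
  fixes V W :: "((real, 'n::{finite,wellorder}) vec, 'n) vec"
  assumes VW: "V ** W = mat 1" and WV: "W ** V = mat 1"
    and f[measurable]: "f \<in> borel_measurable borel"
  shows "(\<integral>\<^sup>+x. f x \<partial>lborel) = ennreal \<bar>det V\<bar> * (\<integral>\<^sup>+y. f (V *v y) \<partial>lborel)"
proof -
  have "(\<integral>\<^sup>+x. f x \<partial>lborel)
      = (\<integral>\<^sup>+x. f x \<partial>density (distr lborel borel ((*v) V)) (\<lambda>_. ennreal \<bar>det V\<bar>))"
    by (subst lborel_eq_density_linear_image[OF VW WV]) rule
  also have "\<dots> = (\<integral>\<^sup>+y. ennreal \<bar>det V\<bar> * f (V *v y) \<partial>lborel)"
    by (simp add: nn_integral_density nn_integral_distr)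
  finally show ?thesis by (simp add: nn_integral_cmult)
qed


section \<open>Gaussian integrals\<close>

text \<open>The one-dimensional Gaussian integral, read off from the normal density.\<close>
lemma nn_integral_gaussian_real: "(\<integral>\<^sup>+x. ennreal (exp (- x\<^sup>2)) \<partial>lborel) = ennreal (sqrt pi)"
proof -
  define nd where "nd = normal_density 0 (1 / sqrt 2)"
  have nd: "ennreal (sqrt pi) * ennreal (nd x) = ennreal (exp (- x\<^sup>2))" for x
    by (auto simp: nd_def normal_density_def power_divide real_sqrt_divide ennreal_mult[symmetric])
  interpret prob_space "density lborel (\<lambda>x. ennreal (nd x))"
    unfolding nd_def by (rule prob_space_normal_density) simp
  have "(\<integral>\<^sup>+x. ennreal (nd x) \<partial>lborel) = 1"
    using emeasure_space_1 by (simp add: emeasure_density nd_def)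
  then have "ennreal (sqrt pi) = ennreal (sqrt pi) * (\<integral>\<^sup>+x. ennreal (nd x) \<partial>lborel)" by simp
  also have "\<dots> = (\<integral>\<^sup>+x. ennreal (sqrt pi) * ennreal (nd x) \<partial>lborel)"
    by (rule nn_integral_cmult[symmetric]) (simp add: nd_def)
  finally show ?thesis by (simp add: nd)
qed

text \<open>The Gaussian integral over a Euclidean space is the product of one-dimensional ones.\<close>
lemma nn_integral_gaussian_euclidean:
  "(\<integral>\<^sup>+y. ennreal (exp (-(y \<bullet> y))) \<partial>(lborel :: 'a::euclidean_space measure))
    = ennreal (sqrt pi ^ DIM('a))"
proof -
  interpret product_sigma_finite "\<lambda>_. lborel" by standard
  have sq: "(\<Sum>b\<in>Basis. x b *\<^sub>R b) \<bullet> (\<Sum>b\<in>(Basis::'a set). x b *\<^sub>R b) = (\<Sum>b\<in>Basis. (x b)\<^sup>2)" for x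
  proof -
    have "b \<bullet> (\<Sum>b\<in>(Basis::'a set). x b *\<^sub>R b) = x b" if "b \<in> Basis" for b
      using that by (subst inner_commute) (simp add: inner_sum_left_Basis)
    then show ?thesis by (simp add: inner_sum_left power2_eq_square)
  qed
  have "(\<integral>\<^sup>+y. ennreal (exp (-(y \<bullet> y))) \<partial>(lborel :: 'a measure))
      = (\<integral>\<^sup>+y. ennreal (exp (-(y \<bullet> y)))
           \<partial>distr (\<Pi>\<^sub>M b\<in>(Basis::'a set). lborel) borel (\<lambda>f. \<Sum>b\<in>Basis. f b *\<^sub>R b))"
    by (subst lborel_eq) rule
  also have "\<dots> = (\<integral>\<^sup>+x. (\<Prod>b\<in>(Basis::'a set). ennreal (exp (- (x b)\<^sup>2))) \<partial>(\<Pi>\<^sub>M b\<in>Basis. lborel))"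
    by (subst nn_integral_distr) (auto simp: sq exp_sum[symmetric] sum_negf prod_ennreal
        intro!: nn_integral_cong)
  also have "\<dots> = (\<Prod>b\<in>(Basis::'a set). \<integral>\<^sup>+t. ennreal (exp (- t\<^sup>2)) \<partial>lborel)"
    by (rule product_nn_integral_prod) auto
  finally show ?thesis by (simp add: nn_integral_gaussian_real ennreal_power)
qed

lemma inner_matrix_vector_mult: "(e::real^'m) \<bullet> ((V::real^'n^'m) *v y) = (transpose V *v e) \<bullet> y"
  by (metis dot_lmul_matrix inner_commute vector_transpose_matrix)

text \<open>Laplace transform of a centred Gaussian with precision matrix s:
  \<integral> exp(2 e\<cdot>x - x\<cdot>s x) dx = pi^(d/2) det(s)^(-1/2) exp(e\<cdot>s^(-1) e).
  Substituting x = V y with V^T s V = 1 and completing the square reduces it to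
  the standard Gaussian integral.\<close>
lemma nn_integral_gaussian_quadratic:
  fixes s :: "((real, 'n::{finite,wellorder}) vec, 'n) vec" and e :: "(real, 'n) vec"
  assumes s: "s \<in> pos_def_mats"
  shows "(\<integral>\<^sup>+x. ennreal (exp (2 * (e \<bullet> x) - x \<bullet> (s *v x))) \<partial>lborel)
     = ennreal (det s powr (-1/2) * exp (e \<bullet> (matrix_inv s *v e)) * sqrt pi ^ CARD('n))"
proof -
  obtain V W :: "((real, 'n) vec, 'n) vec" where V: "transpose V ** s ** V = mat 1"
    and VW: "V ** W = mat 1" and WV: "W ** V = mat 1"
    and inv: "matrix_inv s = V ** transpose V" and det: "det s powr (-1/2) = \<bar>det V\<bar>"
    using pos_def_normalizing_matrix[OF s] by blast
  define b where "b = transpose V *v e"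
  have bb: "e \<bullet> (matrix_inv s *v e) = b \<bullet> b"
    unfolding inv b_def by (simp add: matrix_vector_mul_assoc[symmetric] inner_matrix_vector_mult)
  have square: "2 * (e \<bullet> (V *v y)) - (V *v y) \<bullet> (s *v (V *v y))
      = b \<bullet> b + - ((-b + y) \<bullet> (-b + y))" for y
  proof -
    have "(V *v y) \<bullet> (s *v (V *v y)) = y \<bullet> ((transpose V ** s ** V) *v y)"
      by (simp only: matrix_vector_mul_assoc[symmetric] inner_matrix_vector_mult transpose_transpose)
    then have quad: "(V *v y) \<bullet> (s *v (V *v y)) = y \<bullet> y" using V by simp
    have lin: "e \<bullet> (V *v y) = b \<bullet> y" unfolding b_def by (rule inner_matrix_vector_mult)
    have "(-b + y) \<bullet> (-b + y) = y \<bullet> y - 2 * (b \<bullet> y) + b \<bullet> b"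
      by (simp add: inner_diff_left inner_diff_right inner_commute[of y b])
    then show ?thesis unfolding quad lin by simp
  qed
  define g where "g = (\<lambda>x. ennreal (exp (2 * (e \<bullet> x) - x \<bullet> (s *v x))))"
  have "(\<integral>\<^sup>+x. g x \<partial>lborel) = ennreal \<bar>det V\<bar> * (\<integral>\<^sup>+y. g (V *v y) \<partial>lborel)"
    by (rule nn_integral_lborel_linear_subst[OF VW WV]) (simp add: g_def)
  also have "(\<integral>\<^sup>+y. g (V *v y) \<partial>lborel)
      = (\<integral>\<^sup>+y. ennreal (exp (b \<bullet> b)) * ennreal (exp (- ((-b + y) \<bullet> (-b + y)))) \<partial>lborel)"
    unfolding g_def square by (simp add: ennreal_mult[symmetric] exp_add[symmetric])
  also have "\<dots> = ennreal (exp (b \<bullet> b)) * (\<integral>\<^sup>+y. ennreal (exp (- ((-b + y) \<bullet> (-b + y)))) \<partial>lborel)"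
    by (rule nn_integral_cmult) measurable
  also have "(\<integral>\<^sup>+y. ennreal (exp (- ((-b + y) \<bullet> (-b + y)))) \<partial>lborel)
      = (\<integral>\<^sup>+z. ennreal (exp (- (z \<bullet> z))) \<partial>distr lborel borel ((+) (-b)))"
    by (subst nn_integral_distr) auto
  also have "\<dots> = ennreal (sqrt pi ^ CARD('n))"
    using nn_integral_gaussian_euclidean[where 'a="(real, 'n) vec"] by (simp add: lborel_distr_plus)
  finally show ?thesis
    unfolding g_def det bb by (simp add: ennreal_mult[symmetric] mult.assoc)
qed


section \<open>Outer products\<close>

definition outer :: "real^'n \<Rightarrow> real^'n^'n" where
  "outer x = (\<chi> i j. x $ i * x $ j)"

lemma outer_zero: "outer 0 = 0"
  by (simp add: outer_def vec_eq_iff)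

lemma outer_borel_measurable[measurable]: "outer \<in> borel_measurable borel"
  unfolding outer_def by (intro borel_measurable_continuous_onI continuous_intros)

lemma trace_mult_borel_measurable[measurable]:
  "(\<lambda>x::real^'n^'n. trace (s ** x)) \<in> borel_measurable borel"
  unfolding trace_def matrix_matrix_mult_def
  by (intro borel_measurable_continuous_onI continuous_intros)

text \<open>tr(B x x^T) is the quadratic form x\<cdot>B x.\<close>
lemma trace_mult_outer: "trace (B ** outer x) = x \<bullet> (B *v x)"
  by (simp add: trace_def matrix_matrix_mult_def outer_def inner_vec_def matrix_vector_mult_def
      sum_distrib_left mult_ac)

text \<open>Adding the positive semidefinite x x^T preserves the cone and its closure.\<close>
lemma pos_def_add_outer: "s \<in> pos_def_mats \<Longrightarrow> s + outer x \<in> pos_def_mats"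
proof -
  assume s: "s \<in> pos_def_mats"
  have "transpose (outer x) = outer x"
    by (simp add: transpose_def outer_def vec_eq_iff mult.commute)
  moreover have "y \<bullet> (outer x *v y) = (x \<bullet> y)\<^sup>2" for y
    by (simp add: outer_def inner_vec_def matrix_vector_mult_def power2_eq_square sum_distrib_left
        sum_distrib_right mult_ac)
  moreover have "transpose (s + outer x) = transpose s + transpose (outer x)"
    by (simp add: transpose_def vec_eq_iff)
  ultimately show ?thesis using s unfolding pos_def_mats_def
    by (auto simp: matrix_vector_mult_add_rdistrib inner_add_right add_pos_nonneg)
qed

lemma closure_pos_def_add_outer:
  assumes "a \<in> closure pos_def_mats"
  shows "a + outer x \<in> closure pos_def_mats"
proof -
  have "(\<lambda>z. z + outer x) ` closure pos_def_mats \<subseteq> closure pos_def_mats"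
    using pos_def_add_outer closure_subset
    by (intro image_closure_subset) (auto intro!: continuous_intros)
  then show ?thesis using assms by blast
qed


section \<open>Laplace representations and the key step\<close>

text \<open>M is a Borel measure on the closed cone whose Laplace transform is
  det(s)^(-p) exp(tr(s^(-1) A)); m_exists asks for this with A = I(k,d).\<close>
definition laplace_rep :: "(real^'n^'n) measure \<Rightarrow> real \<Rightarrow> real^'n^'n \<Rightarrow> bool" where
  "laplace_rep M p A \<longleftrightarrow> sets M = sets borel \<and> emeasure M (UNIV - closure pos_def_mats) = 0 \<and>
     (\<forall>s\<in>pos_def_mats. (\<integral>\<^sup>+ x. ennreal (exp (- trace (s ** x))) \<partial>M)
        = ennreal (det s powr (- p) * exp (trace (matrix_inv s ** A))))"

lemma m_exists2_iff_laplace_rep: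
  "m_exists2 TYPE('n::{finite,wellorder}) n k
     \<longleftrightarrow> (\<exists>M::((real, 'n) vec, 'n) vec measure. laplace_rep M (n / 2) (Imat k))"
  unfolding m_exists2_def m_exists_def laplace_rep_def by simp

text \<open>The Gaussian weight exp(2 e\<cdot>x)/pi^(d/2): its integral of exp(-x\<cdot>s x) is the
  factor det(s)^(-1/2) exp(e\<cdot>s^(-1) e) by which the Laplace transform is multiplied.\<close>
definition gauss_weight :: "real^'n \<Rightarrow> (real^'n) measure" where
  "gauss_weight e = density lborel (\<lambda>x. ennreal (exp (2 * (e \<bullet> x)) / sqrt pi ^ CARD('n)))"

lemma sets_gauss_weight[measurable_cong]: "sets (gauss_weight e) = sets borel"
  by (simp add: gauss_weight_def)

lemma sigma_finite_gauss_weight: "sigma_finite_measure (gauss_weight e)"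
  unfolding gauss_weight_def
  by (subst sigma_finite_measure.sigma_finite_iff_density_finite[OF sigma_finite_lborel]) auto

lemma nn_integral_gauss_weight:
  fixes s :: "((real, 'n::{finite,wellorder}) vec, 'n) vec"
  assumes s: "s \<in> pos_def_mats"
  shows "(\<integral>\<^sup>+x. ennreal (exp (- (x \<bullet> (s *v x)))) \<partial>gauss_weight e)
     = ennreal (det s powr (-1/2) * exp (e \<bullet> (matrix_inv s *v e)))"
proof -
  define c where "c = sqrt pi ^ CARD('n)"
  have c: "c > 0" unfolding c_def by simp
  have "(\<integral>\<^sup>+x. ennreal (exp (- (x \<bullet> (s *v x)))) \<partial>gauss_weight e)
      = (\<integral>\<^sup>+x. ennreal (1 / c) * ennreal (exp (2 * (e \<bullet> x) - x \<bullet> (s *v x))) \<partial>lborel)"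
    unfolding gauss_weight_def c_def[symmetric] using c
    by (subst nn_integral_density) (auto simp: ennreal_mult[symmetric] exp_diff exp_minus
        field_simps intro!: nn_integral_cong)
  also have "\<dots> = ennreal (1 / c) * ennreal (det s powr (-1/2) * exp (e \<bullet> (matrix_inv s *v e)) * c)"
    by (simp add: nn_integral_cmult nn_integral_gaussian_quadratic[OF s] c_def)
  finally show ?thesis using c by (simp add: ennreal_mult[symmetric])
qed

text \<open>The image of M \<otimes> N under (a, x) \<mapsto> a + x x^T is again carried by the closed cone.\<close>
lemma distr_add_outer_on_closed_cone:
  fixes M :: "(real^'n^'n) measure" and N :: "(real^'n) measure"
  assumes sM: "sets M = sets borel" and M0: "emeasure M (UNIV - closure pos_def_mats) = 0"
    and sN: "sets N = sets borel" and N: "sigma_finite_measure N"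
  shows "emeasure (distr (M \<Otimes>\<^sub>M N) borel (\<lambda>z. fst z + outer (snd z))) (UNIV - closure pos_def_mats) = 0"
proof -
  interpret N: sigma_finite_measure N by (rule N)
  define h :: "(real^'n^'n) \<times> (real^'n) \<Rightarrow> real^'n^'n" where "h = (\<lambda>z. fst z + outer (snd z))"
  have h: "h \<in> borel_measurable (M \<Otimes>\<^sub>M N)"
    unfolding measurable_cong_sets[OF sets_pair_measure_cong[OF sM sN] refl] h_def by measurable
  define B where "B = h -` (UNIV - closure pos_def_mats) \<inter> space (M \<Otimes>\<^sub>M N)"
  have B: "B \<in> sets (M \<Otimes>\<^sub>M N)" unfolding B_def by (rule measurable_sets[OF h]) auto
  have AE: "AE a in M. a \<in> closure pos_def_mats"
    by (rule AE_I'[of "UNIV - closure pos_def_mats"]) (auto simp: null_sets_def sM M0)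
  have "emeasure (distr (M \<Otimes>\<^sub>M N) borel h) (UNIV - closure pos_def_mats) = emeasure (M \<Otimes>\<^sub>M N) B"
    unfolding B_def using h by (simp add: emeasure_distr)
  also have "\<dots> = (\<integral>\<^sup>+z. indicator B z \<partial>(M \<Otimes>\<^sub>M N))"
    using B by (rule nn_integral_indicator[symmetric])
  also have "\<dots> = (\<integral>\<^sup>+a. \<integral>\<^sup>+x. indicator B (a, x) \<partial>N \<partial>M)"
    using B by (intro N.nn_integral_fst[symmetric] borel_measurable_indicator)
  also have "\<dots> = (\<integral>\<^sup>+a. 0 \<partial>M)"
    using AE by (intro nn_integral_cong_AE, eventually_elim)
      (simp add: B_def h_def closure_pos_def_add_outer indicator_def)
  finally show ?thesis by (simp add: h_def)
qed

text \<open>Key step: a Laplace representation for (p, A) yields one for (p + 1/2, A + e e^T).\<close>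
lemma laplace_rep_add_outer:
  fixes M :: "((real, 'n::{finite,wellorder}) vec, 'n) vec measure" and e :: "(real, 'n) vec"
  assumes rep: "laplace_rep M p A"
  shows "\<exists>M'. laplace_rep M' (p + 1/2) (A + outer e)"
proof -
  let ?N = "gauss_weight e"
  interpret N: sigma_finite_measure ?N by (rule sigma_finite_gauss_weight)
  have sM: "sets M = sets borel" and M0: "emeasure M (UNIV - closure pos_def_mats) = 0"
    and LT: "\<And>s. s \<in> pos_def_mats \<Longrightarrow> (\<integral>\<^sup>+ x. ennreal (exp (- trace (s ** x))) \<partial>M)
        = ennreal (det s powr (- p) * exp (trace (matrix_inv s ** A)))"
    using rep unfolding laplace_rep_def by auto
  define h :: "((real, 'n) vec, 'n) vec \<times> (real, 'n) vec \<Rightarrow> ((real, 'n) vec, 'n) vec" where "h = (\<lambda>z. fst z + outer (snd z))"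
  have h: "h \<in> borel_measurable (M \<Otimes>\<^sub>M ?N)"
    unfolding measurable_cong_sets[OF sets_pair_measure_cong[OF sM sets_gauss_weight] refl] h_def
    by measurable
  have "laplace_rep (distr (M \<Otimes>\<^sub>M ?N) borel h) (p + 1/2) (A + outer e)"
    unfolding laplace_rep_def
  proof (intro conjI ballI)
    show "emeasure (distr (M \<Otimes>\<^sub>M ?N) borel h) (UNIV - closure pos_def_mats) = 0"
      unfolding h_def using sM M0 sets_gauss_weight sigma_finite_gauss_weight
      by (rule distr_add_outer_on_closed_cone)
  next
    fix s :: "((real, 'n) vec, 'n) vec" assume s: "s \<in> pos_def_mats"
    define G where "G = det s powr (-1/2) * exp (e \<bullet> (matrix_inv s *v e))"
    have split: "exp (- trace (s ** h (a, x))) = exp (- trace (s ** a)) * exp (- (x \<bullet> (s *v x)))"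
      for a x by (simp add: h_def matrix_add_ldistrib trace_add trace_mult_outer exp_add[symmetric])
    have "(\<integral>\<^sup>+ x. ennreal (exp (- trace (s ** x))) \<partial>distr (M \<Otimes>\<^sub>M ?N) borel h)
        = (\<integral>\<^sup>+a. \<integral>\<^sup>+x. ennreal (exp (- trace (s ** a))) * ennreal (exp (- (x \<bullet> (s *v x)))) \<partial>?N \<partial>M)"
      using h by (simp add: nn_integral_distr N.nn_integral_fst[symmetric] split ennreal_mult)
    also have "\<dots> = (\<integral>\<^sup>+a. ennreal (exp (- trace (s ** a))) \<partial>M) * ennreal G"
      unfolding G_def
      by (simp add: nn_integral_cmult nn_integral_gauss_weight[OF s] nn_integral_multc
          measurable_cong_sets[OF sM refl])
    also have "\<dots> = ennreal (det s powr (- (p + 1/2)) * exp (trace (matrix_inv s ** (A + outer e))))"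
    proof -
      have "det s powr (- (p + 1/2)) = det s powr (- p) * det s powr (-1/2)"
        by (subst powr_add[symmetric]) simp
      then show ?thesis
        unfolding LT[OF s] G_def
        by (simp add: ennreal_mult[symmetric] matrix_add_ldistrib trace_add
            trace_mult_outer exp_add mult_ac)
    qed
    finally show "(\<integral>\<^sup>+ x. ennreal (exp (- trace (s ** x))) \<partial>distr (M \<Otimes>\<^sub>M ?N) borel h)
        = ennreal (det s powr (- (p + 1/2)) * exp (trace (matrix_inv s ** (A + outer e))))" .
  qed simp
  then show ?thesis by blast
qed


section \<open>The matrices I(k,d) and iteration of the key step\<close>

text \<open>The rank of an index in the well-order of 'n is a bijection onto {..<d}.\<close>
lemma rank_strict_mono: "strict_mono (\<lambda>i::'n::{finite,wellorder}. card {l. l < i})"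
  by (intro strict_monoI psubset_card_mono) auto

lemma rank_range: "range (\<lambda>i::'n::{finite,wellorder}. card {l. l < i}) = {..<CARD('n)}"
proof (rule card_subset_eq)
  show "range (\<lambda>i::'n. card {l. l < i}) \<subseteq> {..<CARD('n)}"
    by (auto intro!: psubset_card_mono)
  show "card (range (\<lambda>i::'n. card {l. l < i})) = card {..<CARD('n)}"
    using card_image[OF strict_mono_imp_inj_on[OF rank_strict_mono]] by simp
qed simp

text \<open>I(k+1,d) = I(k,d) + e e^T, where e is the standard basis vector of rank d-k-1.\<close>
lemma Imat_Suc:
  assumes k: "k < CARD('n::{finite,wellorder})"
  shows "\<exists>e. (Imat (Suc k) :: ((real, 'n) vec, 'n) vec) = Imat k + outer e"
proof -
  have "CARD('n) - Suc k \<in> range (\<lambda>i::'n. card {l. l < i})"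
    unfolding rank_range using k by simp
  then obtain i0 :: 'n where i0: "card {l. l < i0} = CARD('n) - Suc k" by auto
  have rank_eq: "card {l. l < i} = CARD('n) - Suc k \<longleftrightarrow> i = i0" for i :: 'n
    using strict_mono_eq[OF rank_strict_mono, of i i0] i0 by simp
  have "CARD('n) - Suc k \<le> card {l. l < i} \<longleftrightarrow> CARD('n) - k \<le> card {l. l < i} \<or> i = i0" for i
    using rank_eq[of i] k by auto
  then have "(Imat (Suc k) :: ((real, 'n) vec, 'n) vec) = Imat k + outer (axis i0 1)"
    using i0 k by (auto simp: vec_eq_iff Imat_def outer_def axis_def)
  then show ?thesis by blast
qed

text \<open>Iterating the key step along a chain of rank-one increments B(i+1) = B(i) + e e^T.\<close>
lemma laplace_rep_iterate:
  fixes M :: "((real, 'n::{finite,wellorder}) vec, 'n) vec measure"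
  assumes rep: "laplace_rep M p (B 0)"
    and incr: "\<And>i. i < j \<Longrightarrow> \<exists>e. B (Suc i) = B i + outer e"
  shows "\<exists>M'. laplace_rep M' (p + real j / 2) (B j)"
  using incr
proof (induction j)
  case 0 then show ?case using rep by auto
next
  case (Suc j)
  then obtain M1 where "laplace_rep M1 (p + real j / 2) (B j)" by auto
  moreover obtain e where "B (Suc j) = B j + outer e" using Suc.prems by blast
  ultimately obtain M2 where "laplace_rep M2 (p + real j / 2 + 1/2) (B (Suc j))"
    using laplace_rep_add_outer by metis
  moreover have "p + real j / 2 + 1/2 = p + real (Suc j) / 2" by simp
  ultimately show ?case by auto
qed

text \<open>If m(n,k,d) exists, so does m(n+j,k,d) (increments e = 0).\<close>
lemma m_exists2_raise_n:
  assumes "m_exists2 TYPE('n::{finite,wellorder}) n k"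
  shows "m_exists2 TYPE('n) (n + real j) k"
proof -
  obtain M :: "((real, 'n) vec, 'n) vec measure" where "laplace_rep M (n / 2) (Imat k)"
    using assms m_exists2_iff_laplace_rep by blast
  then obtain M' :: "((real, 'n) vec, 'n) vec measure"
    where "laplace_rep M' (n / 2 + real j / 2) (Imat k)"
    using laplace_rep_iterate[of M "n / 2" "\<lambda>_. Imat k" j] outer_zero by force
  then show ?thesis
    unfolding m_exists2_iff_laplace_rep by (auto simp: add_divide_distrib)
qed

text \<open>If m(n,k,d) exists and k+j \<le> d, so does m(n+j,k+j,d) (increments from Imat_Suc).\<close>
lemma m_exists2_raise_nk:
  assumes "m_exists2 TYPE('n::{finite,wellorder}) n k" and "k + j \<le> CARD('n)"
  shows "m_exists2 TYPE('n) (n + real j) (k + j)"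
proof -
  obtain M :: "((real, 'n) vec, 'n) vec measure" where rep: "laplace_rep M (n / 2) (Imat k)"
    using assms m_exists2_iff_laplace_rep by blast
  have "\<exists>e. (Imat (k + Suc i) :: ((real, 'n) vec, 'n) vec) = Imat (k + i) + outer e" if "i < j" for i
    using Imat_Suc[where 'n='n, of "k + i"] that assms(2) by simp
  then obtain M' :: "((real, 'n) vec, 'n) vec measure"
    where "laplace_rep M' (n / 2 + real j / 2) (Imat (k + j))"
    using laplace_rep_iterate[of M "n / 2" "\<lambda>i. Imat (k + i)" j] rep by auto
  then show ?thesis
    unfolding m_exists2_iff_laplace_rep by (auto simp: add_divide_distrib)
qed


section \<open>The proposition\<close>

theorem proposition2p3:
  assumes "CARD('n::{finite,wellorder}) \<ge> 3"
  shows "(\<not> m_exists2 TYPE('n) (real CARD('n) - 2) (CARD('n) - 1) \<longrightarrow>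
            (\<forall>n k :: nat. n < k \<and> k < CARD('n) \<longrightarrow> \<not> m_exists2 TYPE('n) (real n) k))
       \<and> (\<not> m_exists2 TYPE('n) (real CARD('n) - 2) CARD('n) \<longrightarrow>
            (\<forall>n :: nat. n \<le> CARD('n) - 2 \<longrightarrow> \<not> m_exists2 TYPE('n) (real n) CARD('n)))"
proof (intro conjI impI allI notI)
  fix n k :: nat
  assume none: "\<not> m_exists2 TYPE('n) (real CARD('n) - 2) (CARD('n) - 1)"
    and nk: "n < k \<and> k < CARD('n)" and ex: "m_exists2 TYPE('n) (real n) k"
  have "m_exists2 TYPE('n) (real n + real (CARD('n) - 1 - k)) (CARD('n) - 1)"
    using m_exists2_raise_nk[OF ex, of "CARD('n) - 1 - k"] nk by simp
  then have "m_exists2 TYPE('n) (real n + real (CARD('n) - 1 - k) + real (k - 1 - n)) (CARD('n) - 1)"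
    by (rule m_exists2_raise_n)
  moreover have "real n + real (CARD('n) - 1 - k) + real (k - 1 - n) = real CARD('n) - 2"
    using nk by (simp add: of_nat_diff)
  ultimately show False using none by simp
next
  fix n :: nat
  assume none: "\<not> m_exists2 TYPE('n) (real CARD('n) - 2) CARD('n)"
    and n: "n \<le> CARD('n) - 2" and ex: "m_exists2 TYPE('n) (real n) CARD('n)"
  have "real n + real (CARD('n) - 2 - n) = real CARD('n) - 2"
    using n assms by (simp add: of_nat_diff)
  then show False using m_exists2_raise_n[OF ex, of "CARD('n) - 2 - n"] none by simp
qed

end
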